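(* There is a deterministic one-pass streaming algorithm for \textsf{Unit Interval Selection} on random order streams that uses $O(|OPT|)$ words of space and has expected approximation factor $0.7401$; that is, for every finite input set $\mathcal{I}$ of closed unit-length intervals on the real line, when the intervals of $\mathcal{I}$ are presented in uniformly random order, the algorithm outputs an independent subset of $\mathcal{I}$ whose expected size (over the random order) is at least $0.7401\cdot|OPT|$.
   Context: \textsf{Unit Interval Selection}: the input is a set $\mathcal{I}$ of $n$ closed intervals $[a,a+1]$ of length $1$ on the real line; two intervals are independent if they are disjoint, and an independent set is a set of pairwise independent intervals. The goal is to output an independent subset of $\mathcal{I}$ of maximum cardinality. $OPT$ denotes an (arbitrary fixed) maximum independent subset of $\mathcal{I}$. In the one-pass random order streaming model the intervals of $\mathcal{I}$ arrive one at a time in an order given by a uniformly random permutation of $\mathcal{I}$, and the algorithm sees each interval once. A word is the amount of space needed to store a single interval. The expected approximation factor is $\mathbb{E}[|\text{output}|]/|OPT|$, with the expectation over the random order of the stream. *)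

theory Defs
  imports "HOL-Probability.Probability" "HOL-Combinatorics.Multiset_Permutations"
begin

definition unit_intervals :: "real set set" where
  "unit_intervals = range (\<lambda>a. {a..a + 1})"

definition independent_subsets :: "'a set set \<Rightarrow> 'a set set set" where
  "independent_subsets I = {S. S \<subseteq> I \<and> disjoint S}"

definition opt :: "'a set set \<Rightarrow> nat" where
  "opt I = Max (card ` independent_subsets I)"

text \<open>
  A memory word holds one interval or one symbol of a constant-size alphabet. Real numbers
  can encode unboundedly many other real numbers, so counting words is meaningful only if the
  possible contents of a word are restricted: \<open>valid_algorithm\<close> below requires that the intervals
  in memory are copies of intervals read from the stream and that all symbols are below a bound
  \<open>K\<close> that does not depend on the input.
\<close>

datatype 'i mem_word = Itv 'i | Sym nat

record 'i streaming_algorithm =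
  init :: "'i mem_word list"
  step :: "'i mem_word list \<Rightarrow> 'i \<Rightarrow> 'i mem_word list"
  result :: "'i mem_word list \<Rightarrow> 'i set"

definition stored :: "'i mem_word list \<Rightarrow> 'i set" where
  "stored m = {J. Itv J \<in> set m}"

definition symbols :: "'i mem_word list \<Rightarrow> nat set" where
  "symbols m = {s. Sym s \<in> set m}"

definition valid_algorithm :: "nat \<Rightarrow> 'i streaming_algorithm \<Rightarrow> bool" where
  "valid_algorithm K A \<longleftrightarrow>
     stored (init A) = {} \<and> symbols (init A) \<subseteq> {..<K} \<and>
     (\<forall>m J. stored (step A m J) \<subseteq> insert J (stored m) \<and> symbols (step A m J) \<subseteq> {..<K}) \<and>
     (\<forall>m. result A m \<subseteq> stored m)"

definition memory_after :: "'i streaming_algorithm \<Rightarrow> 'i list \<Rightarrow> 'i mem_word list" where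
  "memory_after A xs = foldl (step A) (init A) xs"

definition output_of :: "'i streaming_algorithm \<Rightarrow> 'i list \<Rightarrow> 'i set" where
  "output_of A xs = result A (memory_after A xs)"

definition max_space :: "'i streaming_algorithm \<Rightarrow> 'i list \<Rightarrow> nat" where
  "max_space A xs = Max ((\<lambda>k. length (memory_after A (take k xs))) ` {..length xs})"

definition random_order :: "'i set \<Rightarrow> 'i list pmf" where
  "random_order I = pmf_of_set (permutations_of_set I)"

end

theory Submission imports Defs begin

text \<open>
  Write an interval as a cell (the floor of its left end) and a position (the fractional part).
  Intervals of the same cell intersect, cells at distance at least two are independent, and
  intervals of cells \<open>c\<close> and \<open>c + 1\<close> are disjoint iff their positions increase strictly. For every
  cell and every length up to five, the algorithm keeps the chains of consecutive cells ending
  there from the left with smallest position, and those ending there from the right with largest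
  position. If the optimal intervals of consecutive cells arrive in the order of a chain, the
  stored chain ends at least as favourably. Hence a run of consecutive cells of the optimum is
  recovered whenever the arrival times along it first increase and then decrease.

  It remains to delete few cells so that no run has an interior local minimum of the arrival times
  or a monotone stretch of six cells. A cell is a local minimum with probability \<open>1/3\<close>; two minima
  at distance two are destroyed by deleting the cell between them, and the pairs that start a
  maximal sequence of minima at distance two have density \<open>2/15 - 17/315 = 5/63\<close>. So the expected
  deleted fraction is at most \<open>1/3 - 5/63 + 2/720 < 0.2599\<close>.
\<close>

subsection \<open>Arrival order\<close>

primrec before :: "'a list \<Rightarrow> 'a \<Rightarrow> 'a \<Rightarrow> bool" where
  "before [] x y \<longleftrightarrow> False"
| "before (z # zs) x y \<longleftrightarrow> (x = z \<and> y \<in> set zs) \<or> before zs x y"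

lemma before_in_set: "before xs x y \<Longrightarrow> x \<in> set xs \<and> y \<in> set xs"
  by (induction xs) auto

lemma before_snoc: "before (xs @ [z]) x y \<longleftrightarrow> before xs x y \<or> (x \<in> set xs \<and> y = z)"
  by (induction xs) auto

lemma before_filter: "P x \<Longrightarrow> P y \<Longrightarrow> before (filter P xs) x y \<longleftrightarrow> before xs x y"
  by (induction xs) auto

lemma before_map:
  assumes "inj_on f A" "set xs \<subseteq> A" "x \<in> A" "y \<in> A"
  shows "before (map f xs) (f x) (f y) \<longleftrightarrow> before xs x y"
  using assms(2)
proof (induction xs)
  case (Cons z zs)
  then show ?case
    using assms(1,3,4) by (auto dest: inj_onD)
qed simp

lemma before_total:
  "x \<in> set xs \<Longrightarrow> y \<in> set xs \<Longrightarrow> x \<noteq> y \<Longrightarrow> before xs x y \<or> before xs y x"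
  by (induction xs) auto

subsection \<open>Extremal chains of intervals\<close>

definition cell :: "real set \<Rightarrow> int" where
  "cell J = \<lfloor>Inf J\<rfloor>"

definition pos :: "real set \<Rightarrow> real" where
  "pos J = frac (Inf J)"

text \<open>
  The direction \<open>s\<close> is \<open>1\<close> for chains read from left to right and \<open>-1\<close> for chains read from right
  to left; multiplying positions by \<open>s\<close> makes small values favourable in both directions.
\<close>

definition follows :: "int \<Rightarrow> real set \<Rightarrow> real set \<Rightarrow> bool" where
  "follows s x y \<longleftrightarrow> cell y = cell x + s \<and> s * pos x < s * pos y"

text \<open>The index counts comparisons, so index \<open>j\<close> belongs to chains of
  \<open>j + 1\<close> intervals.\<close>

primrec chain_ends :: "int \<Rightarrow> real set set \<Rightarrow> nat \<Rightarrow> real set set" where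
  "chain_ends s T 0 = T"
| "chain_ends s T (Suc j) = {y \<in> T. \<exists>x \<in> chain_ends s T j. follows s x y}"

text \<open>The minimum is meaningful only if some chain of this length ends in the cell
  \<open>c\<close>; \<open>core\<close> restricts itself to such triples.\<close>

definition best :: "int \<Rightarrow> real set set \<Rightarrow> nat \<Rightarrow> int \<Rightarrow> real set" where
  "best s T j c = arg_min_on (\<lambda>y. s * pos y) {y \<in> chain_ends s T j. cell y = c}"

definition core :: "nat \<Rightarrow> real set set \<Rightarrow> real set set" where
  "core n T = {best s T j c | s j c.
     s \<in> {1, -1} \<and> j \<le> n \<and> {y \<in> chain_ends s T j. cell y = c} \<noteq> {}}"

lemma chain_ends_subset: "chain_ends s T j \<subseteq> T"
  by (cases j) auto

lemma chain_ends_mono: "T \<subseteq> T' \<Longrightarrow> chain_ends s T j \<subseteq> chain_ends s T' j"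
  by (induction j) auto

lemma best_props:
  assumes "finite T" "y \<in> chain_ends s T j"
  shows "best s T j (cell y) \<in> chain_ends s T j" "cell (best s T j (cell y)) = cell y"
    "s * pos (best s T j (cell y)) \<le> s * pos y"
proof -
  let ?Y = "{y' \<in> chain_ends s T j. cell y' = cell y}"
  have fin: "finite ?Y"
    using finite_subset[OF chain_ends_subset assms(1)] by simp
  have "?Y \<noteq> {}"
    using assms(2) by auto
  from arg_min_if_finite(1)[OF fin this] arg_min_least[OF fin this, of y "\<lambda>y. s * pos y"]
  show "best s T j (cell y) \<in> chain_ends s T j" "cell (best s T j (cell y)) = cell y"
    "s * pos (best s T j (cell y)) \<le> s * pos y"
    using assms(2) by (auto simp: best_def)
qed

lemma core_subset:
  assumes "finite T"
  shows "core n T \<subseteq> T"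
  using best_props(1)[OF assms] chain_ends_subset unfolding core_def by blast

lemma card_core_le:
  assumes "finite T"
  shows "card (core n T) \<le> 2 * (n + 1) * card (cell ` T)"
proof -
  let ?P = "{1, -1 :: int} \<times> {..n} \<times> cell ` T"
  have "core n T \<subseteq> (\<lambda>(s, j, c). best s T j c) ` ?P"
    using chain_ends_subset unfolding core_def by (force simp: image_iff)
  then have "card (core n T) \<le> card ((\<lambda>(s, j, c). best s T j c) ` ?P)"
    using assms by (intro card_mono) auto
  also have "\<dots> \<le> card ?P"
    using assms by (intro card_image_le) auto
  finally show ?thesis
    by (simp add: card_cartesian_product)
qed

text \<open>Replacing a predecessor by a kept one in the same cell with a smaller value of
  \<open>s * pos\<close> preserves \<open>follows\<close>. By induction, a whole chain leading to a
  best end can therefore be rebuilt from kept intervals.\<close>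

lemma core_keeps_chain_ends:
  assumes "finite T" "s \<in> {1, -1}" "j \<le> n" "y \<in> chain_ends s T j"
  shows "\<exists>y' \<in> chain_ends s (core n T) j. cell y' = cell y \<and> s * pos y' \<le> s * pos y"
  using assms(3,4)
proof (induction j arbitrary: y)
  case (Suc j)
  let ?b = "best s T (Suc j) (cell y)"
  note b = best_props[OF assms(1) Suc.prems(2)]
  have core: "?b \<in> core n T"
    using Suc.prems assms(2) unfolding core_def by blast
  obtain x where x: "x \<in> chain_ends s T j" "follows s x ?b"
    using b(1) by auto
  obtain x' where x': "x' \<in> chain_ends s (core n T) j" "cell x' = cell x" "s * pos x' \<le> s * pos x"
    using Suc.IH[of x] Suc.prems x by auto
  have "follows s x' ?b"
    using x x' by (auto simp: follows_def)
  then have "?b \<in> chain_ends s (core n T) (Suc j)"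
    using core x' by auto
  then show ?case
    using b by blast
next
  case 0
  have "best s T 0 (cell y) \<in> core n T"
    using 0 assms(2) unfolding core_def by blast
  then show ?case
    using best_props[OF assms(1) 0(2)] by auto
qed

section \<open>Maintaining extremal chains along the stream\<close>

definition summary :: "nat \<Rightarrow> real set list \<Rightarrow> real set set" where
  "summary n xs = foldl (\<lambda>S J. core n (insert J S)) {} xs"

lemma summary_Nil [simp]: "summary n [] = {}"
  and summary_snoc [simp]: "summary n (xs @ [x]) = core n (insert x (summary n xs))"
  by (simp_all add: summary_def)

lemma summary_subset: "finite (summary n xs) \<and> summary n xs \<subseteq> set xs"
proof (induction xs rule: rev_induct)
  case (snoc x xs)
  then show ?case
    using core_subset[of "insert x (summary n xs)" n] by (auto intro: finite_subset)
qed simp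

text \<open>
  Chains whose members also arrive in this order, which makes the greedy choice of the algorithm
  at least as good at every step.
\<close>

primrec timed_chain_ends :: "int \<Rightarrow> real set list \<Rightarrow> nat \<Rightarrow> real set set" where
  "timed_chain_ends s xs 0 = set xs"
| "timed_chain_ends s xs (Suc j) =
     {y. \<exists>x \<in> timed_chain_ends s xs j. follows s x y \<and> before xs x y}"

text \<open>All earlier members of a timed chain arrive before its end, so a chain whose end lies in
  \<open>xs\<close> cannot contain the new interval \<open>z\<close>.\<close>

lemma timed_chain_ends_snocD:
  assumes "z \<notin> set xs" "y \<in> timed_chain_ends s (xs @ [z]) j" "y \<in> set xs"
  shows "y \<in> timed_chain_ends s xs j"
  using assms(2,3)
proof (induction j arbitrary: y)
  case (Suc j)
  then obtain x where "x \<in> timed_chain_ends s (xs @ [z]) j" "follows s x y" "before xs x y"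
    using assms(1) by (auto simp: before_snoc)
  then show ?case
    using Suc.IH[of x] before_in_set[of xs x y] by auto
qed simp

lemma summary_keeps_timed_chains:
  assumes "distinct xs" "s \<in> {1, -1}" "j \<le> n" "y \<in> timed_chain_ends s xs j"
  shows "\<exists>y' \<in> chain_ends s (summary n xs) j. cell y' = cell y \<and> s * pos y' \<le> s * pos y"
  using assms(1,3,4)
proof (induction xs arbitrary: j y rule: rev_induct)
  case Nil
  then show ?case by (cases j) auto
next
  case (snoc z xs)
  let ?T = "insert z (summary n xs)"
  have z: "z \<notin> set xs" "distinct xs" and fin: "finite ?T"
    using snoc.prems summary_subset by auto
  have "\<exists>y' \<in> chain_ends s ?T j. cell y' = cell y \<and> s * pos y' \<le> s * pos y"
  proof (cases "y \<in> set xs")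
    case True
    then obtain y' where "y' \<in> chain_ends s (summary n xs) j" "cell y' = cell y"
      "s * pos y' \<le> s * pos y"
      using snoc.IH[OF z(2) snoc.prems(2)] timed_chain_ends_snocD[OF z(1) snoc.prems(3)] by blast
    then show ?thesis
      using chain_ends_mono[of "summary n xs" ?T s j] by blast
  next
    case False
    \<comment> \<open>The chain ends in the new interval, so its predecessor was read earlier. By
      induction a stored chain ends in that predecessor's cell at least as favourably, and
      \<open>z\<close> extends it.\<close>
    have "z \<in> chain_ends s ?T j \<and> y = z"
    proof (cases j)
      case 0
      then show ?thesis
        using False snoc.prems by auto
    next
      case (Suc i)
      then obtain x where x: "x \<in> timed_chain_ends s (xs @ [z]) i" "follows s x y" "x \<in> set xs" "y = z"
        using snoc.prems(3) False by (auto simp: before_snoc dest: before_in_set)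
      then obtain x' where x': "x' \<in> chain_ends s (summary n xs) i" "cell x' = cell x"
        "s * pos x' \<le> s * pos x"
        using snoc.IH[OF z(2), of i x] timed_chain_ends_snocD[OF z(1) x(1)] Suc snoc.prems by auto
      then have "x' \<in> chain_ends s ?T i" "follows s x' z"
        using x chain_ends_mono[of "summary n xs" ?T s i] by (auto simp: follows_def)
      then show ?thesis
        using Suc x by auto
    qed
    then show ?thesis by auto
  qed
  then obtain y' where y': "y' \<in> chain_ends s ?T j" "cell y' = cell y" "s * pos y' \<le> s * pos y"
    by blast
  show ?case
    using core_keeps_chain_ends[OF fin assms(2) snoc.prems(2) y'(1)] y' by force
qed

subsection \<open>Recovering unimodal runs\<close>

lemma unit_interval_eq:
  assumes "J \<in> unit_intervals"
  shows "J = {cell J + pos J .. cell J + pos J + 1}" "0 \<le> pos J" "pos J < 1"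
proof -
  obtain a where "J = {a..a + 1}"
    using assms by (auto simp: unit_intervals_def)
  then show "J = {cell J + pos J .. cell J + pos J + 1}" "0 \<le> pos J" "pos J < 1"
    by (auto simp: cell_def pos_def frac_def) linarith+
qed

lemma disjoint_far_cells:
  assumes "x \<in> unit_intervals" "y \<in> unit_intervals" "cell x + 2 \<le> cell y"
  shows "x \<inter> y = {}"
proof -
  note x = unit_interval_eq[OF assms(1)] and y = unit_interval_eq[OF assms(2)]
  have "real_of_int (cell x) + 2 \<le> cell y"
    using assms(3) by linarith
  then show ?thesis
    by (subst x(1), subst y(1)) (use x(2,3) y(2,3) in auto)
qed

lemma disjoint_adjacent_cells_iff:
  assumes "x \<in> unit_intervals" "y \<in> unit_intervals" "cell y = cell x + 1"
  shows "x \<inter> y = {} \<longleftrightarrow> pos x < pos y"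
proof -
  note x = unit_interval_eq[OF assms(1)] and y = unit_interval_eq[OF assms(2)]
  have "x \<inter> y = {cell y + pos y .. cell x + pos x + 1}"
    by (subst x(1), subst y(1)) (use x(2,3) y(2,3) assms(3) in \<open>auto\<close>)
  then show ?thesis
    using assms(3) by auto
qed

text \<open>Both intervals contain the right boundary \<open>cell x + 1\<close> of their common
  cell.\<close>

lemma inter_same_cell:
  assumes "x \<in> unit_intervals" "y \<in> unit_intervals" "cell x = cell y"
  shows "x \<inter> y \<noteq> {}"
proof -
  note x = unit_interval_eq[OF assms(1)] and y = unit_interval_eq[OF assms(2)]
  have "real_of_int (cell x) + 1 \<in> x \<inter> y"
    by (subst x(1), subst y(1)) (use x(2,3) y(2,3) assms(3) in \<open>auto\<close>)
  then show ?thesis by auto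
qed

text \<open>The relation \<open>lt\<close> stands for the arrival order of the intervals chosen in
  the cells. As for chains, \<open>j\<close> comparisons involve \<open>j + 1\<close> cells.\<close>

primrec rising :: "int set \<Rightarrow> (int \<Rightarrow> int \<Rightarrow> bool) \<Rightarrow> int \<Rightarrow> int \<Rightarrow> nat \<Rightarrow> bool" where
  "rising A lt s c 0 \<longleftrightarrow> c \<in> A"
| "rising A lt s c (Suc j) \<longleftrightarrow> c \<in> A \<and> rising A lt s (c - s) j \<and> lt (c - s) c"

lemma rising_imp_mem: "rising A lt s c j \<Longrightarrow> c \<in> A"
  by (cases j) auto

lemma rising_mono: "rising A lt s c j \<Longrightarrow> A \<subseteq> D \<Longrightarrow> rising D lt s c j"
  by (induction j arbitrary: c) auto

text \<open>Both neighbours must belong to \<open>A\<close>, so the end of a run never counts and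
  deleting a neighbour destroys a minimum.\<close>

definition local_min :: "int set \<Rightarrow> (int \<Rightarrow> int \<Rightarrow> bool) \<Rightarrow> int \<Rightarrow> bool" where
  "local_min A lt c \<longleftrightarrow> c - 1 \<in> A \<and> c \<in> A \<and> c + 1 \<in> A \<and> lt c (c - 1) \<and> lt c (c + 1)"

text \<open>Every cell of \<open>A\<close> gets a stored interval: the best end of a left chain up
  to the peak of its run and of a right chain after it. These intervals have strictly increasing
  positions along each run, hence are independent.\<close>

lemma summary_has_independent:
  fixes rep :: "int \<Rightarrow> real set"
  assumes xs: "distinct xs" "set xs \<subseteq> unit_intervals"
    and rep: "\<And>c. c \<in> A \<Longrightarrow> rep c \<in> set xs \<and> cell (rep c) = c"
    and rep_less: "\<And>c. c \<in> A \<Longrightarrow> c + 1 \<in> A \<Longrightarrow> pos (rep c) < pos (rep (c + 1))"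
    and lt_def: "lt = (\<lambda>c d. before xs (rep c) (rep d))"
    and no_min: "\<And>c. \<not> local_min A lt c"
    and short: "\<And>s c. s \<in> {1, -1} \<Longrightarrow> \<not> rising A lt s c (Suc n)"
  shows "\<exists>X \<in> independent_subsets (summary n xs). card X = card A"
proof -
  define S where "S = summary n xs"
  have finS: "finite S" and S_xs: "S \<subseteq> set xs"
    using summary_subset by (auto simp: S_def)
  have total: "lt c d \<or> lt d c" if "c \<in> A" "d \<in> A" "c \<noteq> d" for c d
    unfolding lt_def using that rep by (intro before_total) metis+
  \<comment> \<open>The number of comparisons in the longest stretch that rises into
    \<open>c\<close> in direction \<open>s\<close>.\<close>
  define rank where "rank s c = (LEAST j. \<not> rising A lt s c (Suc j))" for s c
  have rank: "rank s c \<le> n" "rising A lt s c (rank s c)" if "s \<in> {1, -1}" "c \<in> A" for s c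
  proof -
    show "rank s c \<le> n"
      unfolding rank_def using short[OF that(1)] by (rule Least_le)
    show "rising A lt s c (rank s c)"
    proof (cases "rank s c")
      case (Suc k)
      then show ?thesis
        using not_less_Least[of k "\<lambda>j. \<not> rising A lt s c (Suc j)"] by (simp add: rank_def)
    qed (use that in simp)
  qed
  \<comment> \<open>Taking the longest stretch makes ranks grow by exactly one, so a chain for
    \<open>c\<close> restricts to a chain of the length used for \<open>c - s\<close>.\<close>
  have rank_Suc: "rank s c = Suc (rank s (c - s))"
    if "s \<in> {1, -1}" "c \<in> A" "c - s \<in> A" "lt (c - s) c" for s c
    unfolding rank_def
    by (subst Least_Suc[where n = n]) (use that short[OF that(1), of c] in \<open>auto simp: numeral_2_eq_2 gr0_conv_Suc\<close>)
  have timed: "rep c \<in> timed_chain_ends s xs j" if "s \<in> {1, -1}" "rising A lt s c j" for s c j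
    using that(2)
  proof (induction j arbitrary: c)
    case (Suc j)
    then have "rep (c - s) \<in> timed_chain_ends s xs j" "c \<in> A" "c - s \<in> A" "lt (c - s) c"
      using rising_imp_mem by auto
    moreover have "follows s (rep (c - s)) (rep c)"
      using that(1) calculation rep rep_less[of "c - 1"] rep_less[of c] by (auto simp: follows_def)
    ultimately show ?case
      by (auto simp: lt_def)
  qed (use rep in auto)
  define out where "out s c = best s S (rank s c) c" for s c
  have out: "out s c \<in> chain_ends s S (rank s c)" "cell (out s c) = c"
    "s * pos (out s c) \<le> s * pos (rep c)"
    "\<And>y. y \<in> chain_ends s S (rank s c) \<Longrightarrow> cell y = c \<Longrightarrow> s * pos (out s c) \<le> s * pos y"
    if sc: "s \<in> {1, -1}" "c \<in> A" for s c
  proof -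
    obtain y where y: "y \<in> chain_ends s S (rank s c)" "cell y = c" "s * pos y \<le> s * pos (rep c)"
      using summary_keeps_timed_chains[OF xs(1) sc(1) rank(1)[OF sc] timed[OF sc(1) rank(2)[OF sc]]]
        rep sc(2) by (auto simp: S_def)
    show "out s c \<in> chain_ends s S (rank s c)" "cell (out s c) = c"
      "s * pos (out s c) \<le> s * pos (rep c)"
      using best_props[OF finS y(1)] y(2,3) by (auto simp: out_def)
    show "s * pos (out s c) \<le> s * pos z" if "z \<in> chain_ends s S (rank s c)" "cell z = c" for z
      using best_props[OF finS that(1)] that(2) by (auto simp: out_def)
  qed
  \<comment> \<open>The predecessor of \<open>out s c\<close> competes with
    \<open>out s (c - s)\<close> in the same minimization, so the latter is at least as
    favourable.\<close>
  have out_step: "s * pos (out s (c - s)) < s * pos (out s c)"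
    if "s \<in> {1, -1}" "c \<in> A" "c - s \<in> A" "lt (c - s) c" for s c
  proof -
    have "out s c \<in> chain_ends s S (Suc (rank s (c - s)))"
      using out(1)[OF that(1,2)] rank_Suc[OF that] by simp
    then obtain y where y: "y \<in> chain_ends s S (rank s (c - s))" "follows s y (out s c)"
      by auto
    then have "cell y = c - s"
      using out(2)[OF that(1,2)] by (auto simp: follows_def)
    then show ?thesis
      using out(4)[OF that(1,3) y(1)] y(2) by (auto simp: follows_def)
  qed
  \<comment> \<open>In the absence of local minima, \<open>up\<close> holds on an initial part of each run and fails on the rest,
    so left chains are used up to the peak of the arrival times and right chains after it.\<close>
  define up where "up c \<longleftrightarrow> c - 1 \<notin> A \<or> lt (c - 1) c" for c
  define sel where "sel c = out (if up c then 1 else -1) c" for c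
  have sel: "sel c \<in> S" "cell (sel c) = c" "sel c \<in> unit_intervals" if "c \<in> A" for c
    using out(1,2)[of 1 c] out(1,2)[of "-1" c] that chain_ends_subset S_xs xs(2)
    unfolding sel_def by (auto split: if_splits; blast)+
  have sel_less: "pos (sel c) < pos (sel (c + 1))" if c: "c \<in> A" "c + 1 \<in> A" for c
  proof (cases "up (c + 1)")
    case True
    then have lt: "lt c (c + 1)"
      using c by (simp add: up_def)
    \<comment> \<open>Otherwise \<open>c - 1\<close> would be a cell of \<open>A\<close> arriving
      after \<open>c\<close>, which would make \<open>c\<close> a local minimum.\<close>
    then have "up c"
      using no_min[of c] total[of c "c - 1"] c by (auto simp: up_def local_min_def)
    then show ?thesis
      using out_step[of 1 "c + 1"] True lt c by (simp add: sel_def)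
  next
    case False
    then have lt: "lt (c + 1) c"
      using c total[of c "c + 1"] by (simp add: up_def)
    show ?thesis
    proof (cases "up c")
      case True
      \<comment> \<open>At the peak the two directions meet: the left chain ends at or before
        \<open>rep c\<close>, the right chain at or after \<open>rep (c + 1)\<close>, in terms of
        position.\<close>
      then show ?thesis
        using out(3)[of 1 c] out(3)[of "-1" "c + 1"] rep_less[OF c] c False by (simp add: sel_def)
    next
      case up: False
      then show ?thesis
        using out_step[of "-1" c] lt c False by (simp add: sel_def)
    qed
  qed
  have inj: "inj_on sel A"
    using sel(2) by (metis inj_onI)
  have disj: "sel c \<inter> sel d = {}" if "c \<in> A" "d \<in> A" "c < d" for c d
  proof (cases "d = c + 1")
    case True
    then show ?thesis
      using disjoint_adjacent_cells_iff[of "sel c" "sel d"] sel that sel_less[of c] by auto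
  next
    case False
    then show ?thesis
      using disjoint_far_cells[of "sel c" "sel d"] sel that by auto
  qed
  have "disjoint (sel ` A)"
  proof (rule disjointI)
    fix a b assume "a \<in> sel ` A" "b \<in> sel ` A" "a \<noteq> b"
    then obtain c d where "a = sel c" "b = sel d" "c \<in> A" "d \<in> A" "c \<noteq> d"
      by auto
    then show "a \<inter> b = {}"
      using disj[of c d] disj[of d c] by (cases "c < d") auto
  qed
  then have "sel ` A \<in> independent_subsets S"
    using sel(1) by (auto simp: independent_subsets_def)
  then show ?thesis
    using card_image[OF inj] by (auto simp: S_def)
qed

section \<open>Deleting cells to make all runs unimodal\<close>

text \<open>Passing to a subset creates neither local minima nor rising stretches, so it suffices to
  destroy those of \<open>D\<close>. Each minimum costs one cell, except that a pair around an
  element of \<open>B\<close> costs one cell altogether; each long stretch loses its last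
  cell.\<close>

lemma exists_unimodal_cells:
  assumes fin: "finite D"
  shows "\<exists>A \<subseteq> D. (\<forall>c. \<not> local_min A lt c) \<and> (\<forall>s \<in> {1, -1}. \<forall>c. \<not> rising A lt s c m) \<and>
    card D + card {c. local_min D lt (c - 1) \<and> local_min D lt (c + 1) \<and> \<not> local_min D lt (c - 3)}
    \<le> card A + card {c. local_min D lt c}
       + (card {c. rising D lt 1 c m} + card {c. rising D lt (-1) c m})"
proof -
  define M where "M = {c. local_min D lt c}"
  define B where "B = {c. local_min D lt (c - 1) \<and> local_min D lt (c + 1) \<and> \<not> local_min D lt (c - 3)}"
  define R where "R s = {c. rising D lt s c m}" for s
  \<comment> \<open>Each element of \<open>B\<close> replaces the two minima next to it; these pairs of minima are disjoint.\<close>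
  define K where "K = (M - ((\<lambda>c. c - 1) ` B \<union> (\<lambda>c. c + 1) ` B)) \<union> B"
  define A where "A = D - (K \<union> (R 1 \<union> R (-1)))"
  have finM: "finite M"
    by (rule finite_subset[OF _ fin]) (auto simp: M_def local_min_def)
  have finB: "finite B"
    by (rule finite_subset[OF _ fin]) (auto simp: B_def local_min_def)
  have finR: "finite (R s)" for s
    by (rule finite_subset[OF _ fin]) (auto simp: R_def dest: rising_imp_mem)
  \<comment> \<open>If \<open>c - 1 = d + 1\<close> with \<open>c\<close> and \<open>d\<close> in
    \<open>B\<close>, then \<open>c - 3 = d - 1\<close> is a minimum, contradicting \<open>c\<close>
    in \<open>B\<close>.\<close>
  have "card ((\<lambda>c. c - 1) ` B \<union> (\<lambda>c. c + 1) ` B) = card B + card B"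
    by (subst card_Un_disjoint) (use finB in \<open>auto simp: B_def card_image\<close>)
  moreover have sub: "(\<lambda>c. c - 1) ` B \<union> (\<lambda>c. c + 1) ` B \<subseteq> M"
    by (auto simp: B_def M_def)
  ultimately have cM: "card (M - ((\<lambda>c. c - 1) ` B \<union> (\<lambda>c. c + 1) ` B)) + (card B + card B) = card M"
    using card_Diff_subset[OF _ sub] finB card_mono[OF finM sub] by simp
  have "card K \<le> card (M - ((\<lambda>c. c - 1) ` B \<union> (\<lambda>c. c + 1) ` B)) + card B"
    unfolding K_def by (rule card_Un_le)
  then have "card K + card B \<le> card M"
    using cM by simp
  moreover have "card D \<le> card A + (card K + (card (R 1) + card (R (-1))))"
  proof -
    have "card D \<le> card (A \<union> (K \<union> (R 1 \<union> R (-1))))"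
      by (rule card_mono) (use finM finB finR fin in \<open>auto simp: A_def K_def\<close>)
    also have "\<dots> \<le> card A + (card K + (card (R 1) + card (R (-1))))"
      by (meson add_left_mono card_Un_le order_trans)
    finally show ?thesis .
  qed
  ultimately have "card D + card B \<le> card A + card M + (card (R 1) + card (R (-1)))"
    by simp
  moreover have "\<not> local_min A lt c" for c
  proof
    assume *: "local_min A lt c"
    then have "c \<in> M" "c - 1 \<notin> K" "c \<notin> K" "c + 1 \<notin> K"
      by (auto simp: local_min_def M_def A_def)
    \<comment> \<open>A minimum that was not deleted itself belongs to a pair, and then the deleted
      middle cell of that pair is its neighbour.\<close>
    then consider b where "b \<in> B" "c = b - 1" | b where "b \<in> B" "c = b + 1"
      by (auto simp: K_def)
    then have "c + 1 \<in> B \<or> c - 1 \<in> B"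
      by cases simp_all
    then show False
      using \<open>c - 1 \<notin> K\<close> \<open>c + 1 \<notin> K\<close> by (auto simp: K_def)
  qed
  moreover have "\<not> rising A lt s c m" if "s \<in> {1, -1}" for s c
    using rising_mono[of A lt s c m D] rising_imp_mem[of A lt s c m] that
    by (auto simp: A_def R_def)
  moreover have "A \<subseteq> D"
    by (auto simp: A_def)
  ultimately show ?thesis
    unfolding M_def B_def R_def by (intro exI[of _ A] conjI ballI allI)
qed

subsection \<open>Probabilities of precedence patterns\<close>

text \<open>
  The first argument must be the length of \<open>as\<close>; \<open>(a, b)\<close> in \<open>R\<close> requires \<open>a\<close> to precede \<open>b\<close>.
\<close>

fun linear_extensions :: "nat \<Rightarrow> nat list \<Rightarrow> (nat \<times> nat) list \<Rightarrow> nat" where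
  "linear_extensions 0 as R = 1"
| "linear_extensions (Suc n) as R =
     sum_list (map (\<lambda>a. if list_ex (\<lambda>p. snd p = a) R then 0
       else linear_extensions n (remove1 a as) (filter (\<lambda>p. fst p \<noteq> a) R)) as)"


text \<open>Split by the first element \<open>a\<close>. It can come first iff no pair has it as
  second component; the pairs with first component \<open>a\<close> then hold automatically and are
  dropped.\<close>

lemma card_linear_extensions:
  assumes "distinct as" "set R \<subseteq> set as \<times> set as"
  shows "card {xs \<in> permutations_of_set (set as). \<forall>(a, b) \<in> set R. before xs a b} =
    linear_extensions (length as) as R"
  using assms
proof (induction "length as" arbitrary: as R)
  case 0
  then have "{xs \<in> permutations_of_set (set as). \<forall>(a, b) \<in> set R. before xs a b} = {[]}"
    by auto
  then show ?case using 0 by simp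
next
  case (Suc n)
  let ?E = "\<lambda>as R. {xs \<in> permutations_of_set (set as). \<forall>(a, b) \<in> set R. before xs a b}"
  let ?R = "\<lambda>a. filter (\<lambda>p. fst p \<noteq> a) R"
  have ne: "set as \<noteq> {}" using Suc(2) by auto
  have split: "?E as R = (\<Union>a \<in> set as. {a # ys |ys. a # ys \<in> ?E as R})"
    using permutations_of_set_nonempty[OF ne] by auto
  have fin: "finite {a # ys |ys. a # ys \<in> ?E as R}" for a
    by (rule finite_subset[of _ "permutations_of_set (set as)"]) auto
  have one: "card {a # ys |ys. a # ys \<in> ?E as R} = (if list_ex (\<lambda>p. snd p = a) R then 0
       else linear_extensions n (remove1 a as) (?R a))" if a: "a \<in> set as" for a
  proof (cases "list_ex (\<lambda>p. snd p = a) R")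
    case True
    then obtain b where "(b, a) \<in> set R"
      by (auto simp: list_ex_iff)
    then have "{a # ys |ys. a # ys \<in> ?E as R} = {}"
      by (fastforce simp: permutations_of_set_def dest: before_in_set)
    then show ?thesis using True by (simp only: card.empty if_True)
  next
    case False
    have "a # ys \<in> ?E as R \<longleftrightarrow> ys \<in> ?E (remove1 a as) (?R a)" for ys
    proof -
      have perm: "a # ys \<in> permutations_of_set (set as) \<longleftrightarrow> ys \<in> permutations_of_set (set (remove1 a as))"
        using a Suc.prems(1) by (auto simp: permutations_of_set_def)
      show ?thesis
      proof (cases "ys \<in> permutations_of_set (set (remove1 a as))")
        case True
        then have set_ys: "set ys = set as - {a}"
          using Suc.prems(1) by (auto simp: permutations_of_set_def)
        have "before (a # ys) b c \<longleftrightarrow> b \<noteq> a \<longrightarrow> before ys b c" if "(b, c) \<in> set R" for b c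
        proof -
          have "c \<in> set ys"
            using that Suc.prems(2) False set_ys by (auto simp: list_ex_iff)
          then show ?thesis by auto
        qed
        then show ?thesis
          using True perm by auto
      qed (use perm in auto)
    qed
    then have "{a # ys |ys. a # ys \<in> ?E as R} = (#) a ` ?E (remove1 a as) (?R a)"
      by auto
    then have "card {a # ys |ys. a # ys \<in> ?E as R} = card (?E (remove1 a as) (?R a))"
      by (simp add: card_image)
    also have "\<dots> = linear_extensions (length (remove1 a as)) (remove1 a as) (?R a)"
      by (rule Suc.hyps(1)) (use a Suc.hyps(2) Suc.prems False in \<open>auto simp: length_remove1 list_ex_iff\<close>)
    also have "length (remove1 a as) = n"
      using a Suc.hyps(2) by (simp add: length_remove1)
    finally show ?thesis
      using False by simp
  qed
  have "card (?E as R) = (\<Sum>a \<in> set as. card {a # ys |ys. a # ys \<in> ?E as R})"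
    by (subst split, rule card_UN_disjoint) (use fin in auto)
  also have "\<dots> = (\<Sum>a \<in> set as. if list_ex (\<lambda>p. snd p = a) R then 0
       else linear_extensions n (remove1 a as) (?R a))"
    using one by (intro sum.cong) auto
  also have "\<dots> = linear_extensions (length as) as R"
    using Suc.prems(1) by (simp add: Suc.hyps(2)[symmetric] sum_list_distinct_conv_sum_set)
  finally show ?case .
qed

text \<open>Partitioning a uniform permutation yields two independent uniform permutations, and
  filtering is the first component.\<close>

lemma filter_random_order:
  assumes "finite I" "Y \<subseteq> I"
  shows "map_pmf (filter (\<lambda>x. x \<in> Y)) (random_order I) = random_order Y"
proof -
  have "map_pmf (filter (\<lambda>x. x \<in> Y)) (random_order I) =
      map_pmf fst (map_pmf (partition (\<lambda>x. x \<in> Y)) (random_order I))"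
    by (simp add: pmf.map_comp o_def)
  also have "\<dots> = random_order {x \<in> I. x \<in> Y}"
    unfolding random_order_def partition_random_permutations[OF assms(1)] by (rule map_fst_pair_pmf)
  also have "{x \<in> I. x \<in> Y} = Y"
    using assms(2) by auto
  finally show ?thesis .
qed

text \<open>The event depends only on the relative order of the \<open>n\<close> elements
  \<open>f i\<close>, which is uniform.\<close>

lemma prob_precedences:
  assumes fin: "finite I" and inj: "inj_on f {..<n}" and img: "f ` {..<n} \<subseteq> I"
    and R: "set R \<subseteq> {..<n} \<times> {..<n}"
  shows "measure_pmf.prob (random_order I) {xs. \<forall>(i, j) \<in> set R. before xs (f i) (f j)} =
    linear_extensions n [0..<n] R / fact n"
proof -
  let ?Y = "f ` {..<n}"
  let ?N = "permutations_of_set {..<n}"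
  let ?E = "{xs. \<forall>(i, j) \<in> set R. before xs (f i) (f j)}"
  have "measure_pmf.prob (random_order I) ?E =
      measure_pmf.prob (random_order I) (filter (\<lambda>x. x \<in> ?Y) -` ?E)"
    by (rule arg_cong[where f = "measure_pmf.prob _"]) (use R in \<open>fastforce simp: before_filter\<close>)
  also have "\<dots> = measure_pmf.prob (random_order ?Y) ?E"
    by (subst filter_random_order[OF fin img, symmetric]) (rule measure_map_pmf[symmetric])
  also have "\<dots> = card (permutations_of_set ?Y \<inter> ?E) / card (permutations_of_set ?Y)"
    unfolding random_order_def by (rule measure_pmf_of_set) auto
  also have "card (permutations_of_set ?Y) = fact n"
    using inj by (simp add: card_image)
  also have "permutations_of_set ?Y = map f ` ?N"
    using inj by (rule permutations_of_set_image_inj)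
  also have "map f ` ?N \<inter> ?E = map f ` {xs \<in> ?N. \<forall>(i, j) \<in> set R. before xs i j}"
  proof -
    have "before (map f xs) (f i) (f j) \<longleftrightarrow> before xs i j" if "xs \<in> ?N" "(i, j) \<in> set R" for xs i j
      using before_map[OF inj, of xs i j] that R by (auto simp: permutations_of_set_def)
    then show ?thesis by fastforce
  qed
  also have "card \<dots> = card {xs \<in> ?N. \<forall>(i, j) \<in> set R. before xs i j}"
  proof (rule card_image)
    show "inj_on (map f) {xs \<in> ?N. \<forall>(i, j) \<in> set R. before xs i j}"
      using inj by (intro inj_on_mapI) (auto simp: permutations_of_set_def inj_on_def)
  qed
  also have "\<dots> = linear_extensions n [0..<n] R"
    using card_linear_extensions[of "[0..<n]" R] R by (simp add: atLeast0LessThan)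
  finally show ?thesis by simp
qed

subsection \<open>Expected number of surviving cells\<close>

lemma expectation_card_Collect:
  assumes "finite D" "\<And>xs c. \<phi> xs c \<Longrightarrow> c \<in> D"
  shows "measure_pmf.expectation p (\<lambda>xs. real (card {c. \<phi> xs c})) =
    (\<Sum>c \<in> D. measure_pmf.prob p {xs. \<phi> xs c})"
proof -
  have "real (card {c. \<phi> xs c}) = (\<Sum>c \<in> D. indicator {xs. \<phi> xs c} xs)" for xs
  proof -
    have "{c. \<phi> xs c} = {c \<in> D. \<phi> xs c}"
      using assms(2) by auto
    then show ?thesis
      using assms(1) by (simp add: indicator_def sum.If_cases Int_def)
  qed
  then show ?thesis
    by (simp add: measure_pmf.emeasure_eq_measure)
qed

lemma expectation_card_le:
  fixes r :: real
  assumes "finite N" "\<And>xs c. \<phi> xs c \<Longrightarrow> c \<in> N"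
    "\<And>c. c \<in> N \<Longrightarrow> measure_pmf.prob p {xs. \<phi> xs c} \<le> r"
  shows "measure_pmf.expectation p (\<lambda>xs. real (card {c. \<phi> xs c})) \<le> card N * r"
  using sum_bounded_above[of N "\<lambda>c. measure_pmf.prob p {xs. \<phi> xs c}" r] assms
  by (subst expectation_card_Collect[of N]) auto

text \<open>The second erosion removes at most as many cells as the first: the ends of runs of
  \<open>E D\<close> inject into the removed cells of \<open>D\<close> next to them. This bounds
  from below the room for pairs of minima when there is much room for single ones.\<close>

lemma card_erosion:
  fixes D :: "int set"
  assumes "finite D"
  defines "E \<equiv> \<lambda>X. {c \<in> X. c - 1 \<in> X \<and> c + 1 \<in> X}"
  shows "2 * card (E D) \<le> card D + card (E (E D))"
proof -
  let ?h = "\<lambda>c. if c + 1 \<in> E D then c - 1 else c + 1"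
  have sub: "E (E D) \<subseteq> E D" "E D \<subseteq> D" by (auto simp: E_def)
  have fin: "finite (E D)" "finite (E (E D))"
    using finite_subset[OF sub(2) assms(1)] finite_subset[OF sub(1)] by auto
  have "card (E D - E (E D)) \<le> card (D - E D)"
  proof (rule card_inj_on_le[of ?h])
    show "inj_on ?h (E D - E (E D))"
    proof (rule inj_onI)
      \<comment> \<open>Distinct runs of \<open>E D\<close> are at least two cells apart, so the
        right neighbour of one is never the left neighbour of the next.\<close>
      have E_mid: "c + 1 \<in> E D" if "c \<in> E D" "c + 2 \<in> E D" for c
        using that by (simp add: E_def add.commute)
      fix c d assume "c \<in> E D - E (E D)" "d \<in> E D - E (E D)" "?h c = ?h d"
      then show "c = d"
        using E_mid[of c] E_mid[of d] by (cases "c + 1 \<in> E D"; cases "d + 1 \<in> E D") (auto simp: add.commute)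
    qed
    show "?h ` (E D - E (E D)) \<subseteq> D - E D"
    proof
      fix b assume "b \<in> ?h ` (E D - E (E D))"
      then obtain c where c: "c \<in> E D" "c \<notin> E (E D)" "b = ?h c"
        by blast
      have "c \<in> E (E D) \<longleftrightarrow> c \<in> E D \<and> c - 1 \<in> E D \<and> c + 1 \<in> E D"
        by (simp add: E_def)
      then have "b \<notin> E D"
        using c by auto
      moreover have "b \<in> D"
        using c(1,3) by (simp add: E_def)
      ultimately show "b \<in> D - E D" by simp
    qed
  qed (use assms(1) in simp)
  then show ?thesis
    using card_Diff_subset[OF fin(2) sub(1)] card_Diff_subset[OF fin(1) sub(2)]
      card_mono[OF fin(1) sub(1)] card_mono[OF assms(1) sub(2)] by linarith
qed

context
  fixes I :: "'a set" and D :: "int set" and rep :: "int \<Rightarrow> 'a" and lt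
  assumes fin: "finite I" and inj: "inj_on rep D" and img: "rep ` D \<subseteq> I"
  defines "lt \<equiv> \<lambda>xs c d. before xs (rep c) (rep d)"
begin

lemma prob_window:
  assumes s: "s \<in> {1, -1}" and mem: "\<And>i. i < n \<Longrightarrow> a + s * int i \<in> D" and R: "set R \<subseteq> {..<n} \<times> {..<n}"
  shows "measure_pmf.prob (random_order I) {xs. \<forall>(i, j) \<in> set R. lt xs (a + s * int i) (a + s * int j)} =
    linear_extensions n [0..<n] R / fact n"
  unfolding lt_def
proof (rule prob_precedences[OF fin _ _ R])
  show "inj_on (\<lambda>i. rep (a + s * int i)) {..<n}"
    using mem s by (intro inj_onI) (auto dest!: inj_onD[OF inj])
  show "(\<lambda>i. rep (a + s * int i)) ` {..<n} \<subseteq> I"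
    using mem img by auto
qed

lemma prob_local_min:
  assumes "c - 1 \<in> D" "c \<in> D" "c + 1 \<in> D"
  shows "measure_pmf.prob (random_order I) {xs. local_min D (lt xs) c} = 1 / 3"
proof -
  have mem: "c - 1 + 1 * int i \<in> D" if "i < 3" for i
    using that assms by (auto simp: less_Suc_eq numeral_eq_Suc add.commute)
  have "{xs. local_min D (lt xs) c} =
      {xs. \<forall>(i, j) \<in> set [(1, 0), (1, 2)]. lt xs (c - 1 + 1 * int i) (c - 1 + 1 * int j)}"
    using assms by (auto simp: local_min_def add.commute)
  moreover have "linear_extensions 3 [0..<3] [(1, 0), (1, 2)] = 2"
    by code_simp
  ultimately show ?thesis
    using prob_window[of 1 3 "c - 1" "[(1, 0), (1, 2)]"] mem by (simp add: fact_numeral)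
qed

text \<open>Subtract the probability of three minima in a row at distance two from that of two:
  \<open>2/15 - 17/315 = 5/63\<close>. If \<open>c - 4\<close> or \<open>c - 3\<close> is missing, a
  third minimum is impossible.\<close>

lemma prob_two_local_mins:
  assumes "c - 2 \<in> D" "c - 1 \<in> D" "c \<in> D" "c + 1 \<in> D" "c + 2 \<in> D"
  shows "measure_pmf.prob (random_order I)
    {xs. local_min D (lt xs) (c - 1) \<and> local_min D (lt xs) (c + 1) \<and> \<not> local_min D (lt xs) (c - 3)}
    \<ge> 5 / 63" (is "measure_pmf.prob ?p ?E \<ge> _")
proof -
  let ?E5 = "{xs. local_min D (lt xs) (c - 1) \<and> local_min D (lt xs) (c + 1)}"
  let ?F = "{xs. local_min D (lt xs) (c - 3)}"
  let ?R5 = "[(1, 0), (1, 2), (3, 2), (3, 4)] :: (nat \<times> nat) list"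
  let ?R7 = "[(1, 0), (1, 2), (3, 2), (3, 4), (5, 4), (5, 6)] :: (nat \<times> nat) list"
  have mem: "c - 2 + 1 * int i \<in> D" if "i < 5" for i
    using that assms by (auto simp: less_Suc_eq numeral_eq_Suc add.commute)
  have E5: "?E5 = {xs. \<forall>(i, j) \<in> set ?R5. lt xs (c - 2 + 1 * int i) (c - 2 + 1 * int j)}"
    using assms by (auto simp: local_min_def algebra_simps)
  \<comment> \<open>The pattern is an alternating permutation; 16 and, for seven cells, 272 are the
    tangent numbers.\<close>
  have "linear_extensions 5 [0..<5] ?R5 = 16"
    by code_simp
  then have p5: "measure_pmf.prob ?p ?E5 = 2 / 15"
    using prob_window[of 1 5 "c - 2" ?R5] mem unfolding E5 by (simp add: fact_numeral)
  have p7: "measure_pmf.prob ?p (?E5 \<inter> ?F) \<le> 17 / 315"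
  proof (cases "c - 4 \<in> D \<and> c - 3 \<in> D")
    case True
    then have mem: "c - 4 + 1 * int i \<in> D" if "i < 7" for i
      using that assms by (auto simp: less_Suc_eq numeral_eq_Suc add.commute)
    have E7: "?E5 \<inter> ?F = {xs. \<forall>(i, j) \<in> set ?R7. lt xs (c - 4 + 1 * int i) (c - 4 + 1 * int j)}"
      using assms True by (auto simp: local_min_def algebra_simps)
    have "linear_extensions 7 [0..<7] ?R7 = 272"
      by code_simp
    then show ?thesis
      using prob_window[of 1 7 "c - 4" ?R7] mem unfolding E7 by (simp add: fact_numeral)
  next
    case False
    then have "?E5 \<inter> ?F = {}"
      by (auto simp: local_min_def algebra_simps)
    then show ?thesis by (simp only: measure_empty)
  qed
  have "?E = ?E5 - ?F" by auto
  then have "measure_pmf.prob ?p ?E = measure_pmf.prob ?p ?E5 - measure_pmf.prob ?p (?E5 \<inter> ?F)"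
    by (simp only: measure_pmf.finite_measure_Diff' sets_measure_pmf UNIV_I)
  then show ?thesis
    using p5 p7 by simp
qed

text \<open>Five comparisons involve six cells, and exactly one of their 720 orders satisfies them.
  If one of the six cells is missing from \<open>D\<close>, the event is empty.\<close>

lemma prob_rising:
  assumes s: "s \<in> {1, -1}"
  shows "measure_pmf.prob (random_order I) {xs. rising D (lt xs) s c 5} \<le> 1 / 720"
proof (cases "\<forall>i < 6. c - 5 * s + s * int i \<in> D")
  case True
  let ?R = "[(0, 1), (1, 2), (2, 3), (3, 4), (4, 5)] :: (nat \<times> nat) list"
  have "{xs. rising D (lt xs) s c 5} \<subseteq>
      {xs. \<forall>(i, j) \<in> set ?R. lt xs (c - 5 * s + s * int i) (c - 5 * s + s * int j)}"
    by (auto simp: eval_nat_numeral algebra_simps)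
  then have "measure_pmf.prob (random_order I) {xs. rising D (lt xs) s c 5} \<le>
      measure_pmf.prob (random_order I)
        {xs. \<forall>(i, j) \<in> set ?R. lt xs (c - 5 * s + s * int i) (c - 5 * s + s * int j)}"
    by (rule measure_pmf.finite_measure_mono) simp
  also have "\<dots> = linear_extensions 6 [0..<6] ?R / fact 6"
    by (rule prob_window[OF s]) (use True in auto)
  also have "linear_extensions 6 [0..<6] ?R = 1"
    by code_simp
  finally show ?thesis
    by (simp add: fact_numeral)
next
  case False
  then have "{xs. rising D (lt xs) s c 5} = {}"
    by (auto simp: eval_nat_numeral less_Suc_eq algebra_simps)
  then show ?thesis by (simp only: measure_empty)
qed

lemma expected_unimodal_cells:
  assumes finD: "finite D"
  shows "measure_pmf.expectation (random_order I) (\<lambda>xs. real (card D)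
     + card {c. local_min D (lt xs) (c - 1) \<and> local_min D (lt xs) (c + 1) \<and> \<not> local_min D (lt xs) (c - 3)}
     - card {c. local_min D (lt xs) c}
     - (real (card {c. rising D (lt xs) 1 c 5}) + card {c. rising D (lt xs) (-1) c 5}))
   \<ge> 0.7401 * card D"
proof -
  let ?p = "random_order I"
  let ?B = "\<lambda>xs c. local_min D (lt xs) (c - 1) \<and> local_min D (lt xs) (c + 1) \<and> \<not> local_min D (lt xs) (c - 3)"
  \<comment> \<open>Cells of \<open>N\<close> can be local minima; for cells of \<open>N'\<close>
    all cells within distance two lie in \<open>D\<close>, so the bound \<open>5/63\<close>
    applies.\<close>
  define N where "N = {c \<in> D. c - 1 \<in> D \<and> c + 1 \<in> D}"
  define N' where "N' = {c \<in> N. c - 1 \<in> N \<and> c + 1 \<in> N}"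
  have sub: "N \<subseteq> D" "N' \<subseteq> D"
    by (auto simp: N_def N'_def)
  have "finite (set_pmf ?p)"
    using fin by (simp add: random_order_def)
  then have int: "integrable ?p f" for f :: "'a list \<Rightarrow> real"
    by (rule integrable_measure_pmf_finite)
  have M: "measure_pmf.expectation ?p (\<lambda>xs. real (card {c. local_min D (lt xs) c})) \<le> card N * (1 / 3)"
  proof (rule expectation_card_le)
    show "measure_pmf.prob ?p {xs. local_min D (lt xs) c} \<le> 1 / 3" if "c \<in> N" for c
      using prob_local_min[of c] that by (simp add: N_def)
  qed (use finD in \<open>auto simp: N_def local_min_def\<close>)
  have R: "measure_pmf.expectation ?p (\<lambda>xs. real (card {c. rising D (lt xs) s c 5})) \<le> card D * (1 / 720)"
    if "s \<in> {1, -1}" for s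
    by (rule expectation_card_le[OF finD]) (use prob_rising[OF that] rising_imp_mem in blast)+
  have B: "measure_pmf.expectation ?p (\<lambda>xs. real (card {c. ?B xs c})) \<ge> card N' * (5 / 63)"
  proof -
    have "card N' * (5 / 63) \<le> (\<Sum>c \<in> N'. measure_pmf.prob ?p {xs. ?B xs c})"
      by (rule sum_bounded_below) (rule prob_two_local_mins; simp add: N'_def N_def algebra_simps)
    also have "\<dots> = measure_pmf.expectation ?p (\<lambda>xs. real (card {c. ?B xs c}))"
      by (rule expectation_card_Collect[symmetric])
        (use sub finD finite_subset in \<open>auto simp: N'_def N_def local_min_def algebra_simps\<close>)
    finally show ?thesis .
  qed
  have "2 * card N \<le> card D + card N'"
    using card_erosion[OF finD] by (simp add: N_def N'_def)
  moreover have "card N \<le> card D"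
    using finD sub by (intro card_mono)
  ultimately have "2 * real (card N) \<le> real (card D) + real (card N')" "real (card N) \<le> real (card D)"
    by linarith+
  \<comment> \<open>Inserting the lower bound \<open>2 * card N - card D\<close> for
    \<open>card N'\<close> leaves \<open>card N\<close> with coefficient
    \<open>10/63 - 1/3 < 0\<close>. The worst case is thus \<open>card N = card D\<close>, with
    factor \<open>1 - 1/3 + 5/63 - 2/720 > 0.7401\<close>.\<close>
  then have "0.7401 * card D \<le> card D + card N' * (5 / 63) - card N * (1 / 3)
      - (card D * (1 / 720) + card D * (1 / 720) :: real)"
    by (simp add: field_simps)
  also have "\<dots> \<le> card D + measure_pmf.expectation ?p (\<lambda>xs. real (card {c. ?B xs c}))
      - measure_pmf.expectation ?p (\<lambda>xs. real (card {c. local_min D (lt xs) c}))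
      - (measure_pmf.expectation ?p (\<lambda>xs. real (card {c. rising D (lt xs) 1 c 5}))
        + measure_pmf.expectation ?p (\<lambda>xs. real (card {c. rising D (lt xs) (-1) c 5})))"
    using M B R[of 1] R[of "-1"] by simp
  also have "\<dots> = measure_pmf.expectation ?p (\<lambda>xs. real (card D) + card {c. ?B xs c}
     - card {c. local_min D (lt xs) c}
     - (real (card {c. rising D (lt xs) 1 c 5}) + card {c. rising D (lt xs) (-1) c 5}))"
    by (simp add: int)
  finally show ?thesis .
qed

end

subsection \<open>The algorithm\<close>

definition largest_independent :: "'a set set \<Rightarrow> 'a set set" where
  "largest_independent S = arg_max card (\<lambda>X. X \<in> independent_subsets S)"

lemma largest_independent:
  assumes "finite S"
  shows "largest_independent S \<in> independent_subsets S"
    and "X \<in> independent_subsets S \<Longrightarrow> card X \<le> card (largest_independent S)"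
proof -
  have "{} \<in> independent_subsets S"
    by (simp add: independent_subsets_def)
  moreover have "\<forall>X. X \<in> independent_subsets S \<longrightarrow> card X < card S + 1"
    using assms by (auto simp: independent_subsets_def less_Suc_eq_le intro: card_mono)
  ultimately have *: "largest_independent S \<in> independent_subsets S \<and>
      (\<forall>X. X \<in> independent_subsets S \<longrightarrow> card X \<le> card (largest_independent S))"
    unfolding largest_independent_def by (rule arg_max_nat_lemma)
  then show "largest_independent S \<in> independent_subsets S"
    "X \<in> independent_subsets S \<Longrightarrow> card X \<le> card (largest_independent S)"
    by auto
qed

lemma opt_eq_card_largest_independent:
  assumes "finite S"
  shows "opt S = card (largest_independent S)"
proof -
  have "finite (independent_subsets S)"
    using assms by (simp add: independent_subsets_def)
  then show ?thesis
    unfolding opt_def using largest_independent[OF assms] by (intro Max_eqI) auto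
qed

text \<open>Any fixed enumeration without repetition serves: \<open>stored\<close> recovers the set,
  and the length is its cardinality.\<close>

definition words :: "'a set \<Rightarrow> 'a mem_word list" where
  "words S = map Itv (SOME xs. set xs = S \<and> distinct xs)"

lemma words:
  assumes "finite S"
  shows "stored (words S) = S" "symbols (words S) = {}" "length (words S) = card S"
proof -
  let ?xs = "SOME xs. set xs = S \<and> distinct xs"
  have "set ?xs = S \<and> distinct ?xs"
    by (rule someI_ex) (rule finite_distinct_list[OF assms])
  then show "stored (words S) = S" "symbols (words S) = {}" "length (words S) = card S"
    using distinct_card[of ?xs] by (auto simp: words_def stored_def symbols_def)
qed

lemma finite_stored: "finite (stored m)"
proof -
  have "stored m = Itv -` set m"
    by (auto simp: stored_def)
  then show ?thesis
    by (simp add: finite_vimageI inj_def)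
qed

text \<open>Chains, cells and positions are recomputed from the stored intervals, so memory holds no
  symbols and the bound \<open>K = 0\<close> works.\<close>

definition chain_algorithm :: "nat \<Rightarrow> real set streaming_algorithm" where
  "chain_algorithm n = \<lparr>init = [], step = (\<lambda>m J. words (core n (insert J (stored m)))),
     result = (\<lambda>m. largest_independent (stored m))\<rparr>"

lemma valid_chain_algorithm: "valid_algorithm 0 (chain_algorithm n)"
proof -
  have "finite (core n (insert J (stored m)))" "core n (insert J (stored m)) \<subseteq> insert J (stored m)"
    for m J
    using core_subset[of "insert J (stored m)"] finite_stored[of m] by (auto intro: finite_subset)
  moreover have "largest_independent (stored m) \<subseteq> stored m" for m :: "real set mem_word list"
    using largest_independent(1)[OF finite_stored] by (auto simp: independent_subsets_def)
  moreover have "stored [] = {}" "symbols [] = {}"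
    by (simp_all add: stored_def symbols_def)
  ultimately show ?thesis
    by (simp add: valid_algorithm_def chain_algorithm_def words)
qed

lemma memory_chain_algorithm: "memory_after (chain_algorithm n) xs = words (summary n xs)"
proof (induction xs rule: rev_induct)
  case Nil
  have "length (words {} :: real set mem_word list) = 0"
    using words(3)[of "{}"] by simp
  then show ?case
    by (simp add: memory_after_def chain_algorithm_def)
next
  case (snoc x xs)
  then show ?case
    using words(1)[of "summary n xs"] summary_subset[of n xs]
    by (simp add: memory_after_def chain_algorithm_def)
qed

lemma output_chain_algorithm: "output_of (chain_algorithm n) xs = largest_independent (summary n xs)"
  using words(1)[of "summary n xs"] summary_subset[of n xs]
  by (simp add: output_of_def memory_chain_algorithm) (simp add: chain_algorithm_def)

section \<open>Space bound\<close>

text \<open>One interval from each even cell gives an independent set, as these cells are at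
  distance at least two; likewise for the odd cells.\<close>

lemma card_cells_le:
  assumes "finite I" "I \<subseteq> unit_intervals"
  shows "card (cell ` I) \<le> 2 * opt I"
proof -
  let ?r = "inv_into I cell"
  have r: "?r c \<in> I" "cell (?r c) = c" if "c \<in> cell ` I" for c
    using that by (auto intro: inv_into_into f_inv_into_f)
  have half: "card C \<le> opt I" if C: "C \<subseteq> cell ` I" "\<And>c d. c \<in> C \<Longrightarrow> d \<in> C \<Longrightarrow> even (c - d)" for C
  proof -
    have far: "?r c \<inter> ?r d = {}" if "c \<in> C" "d \<in> C" "c < d" for c d
    proof -
      have "c + 2 \<le> d"
        using C(2)[OF that(2,1)] that(3) by presburger
      moreover have "?r c \<in> unit_intervals" "?r d \<in> unit_intervals" "cell (?r c) = c" "cell (?r d) = d"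
        using that C(1) r assms(2) by blast+
      ultimately show ?thesis
        using disjoint_far_cells by simp
    qed
    have "disjoint (?r ` C)"
    proof (rule disjointI)
      fix a b assume "a \<in> ?r ` C" "b \<in> ?r ` C" "a \<noteq> b"
      then obtain c d where "a = ?r c" "b = ?r d" "c \<in> C" "d \<in> C" "c \<noteq> d"
        by blast
      then show "a \<inter> b = {}"
        using far[of c d] far[of d c] by (cases "c < d") auto
    qed
    then have "?r ` C \<in> independent_subsets I"
      using C(1) r(1) by (auto simp: independent_subsets_def)
    then have "card (?r ` C) \<le> opt I"
      using largest_independent(2)[OF assms(1)] opt_eq_card_largest_independent[OF assms(1)] by simp
    moreover have "inj_on ?r C"
      using C(1) by (rule inj_on_inv_into)
    ultimately show ?thesis
      by (simp add: card_image)
  qed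
  let ?C = "\<lambda>P. {c \<in> cell ` I. P c}"
  have "cell ` I = ?C even \<union> ?C odd" by auto
  then have "card (cell ` I) \<le> card (?C even) + card (?C odd)"
    by (metis card_Un_le)
  moreover have "card (?C even) \<le> opt I" "card (?C odd) \<le> opt I"
    by (rule half; force)+
  ultimately show ?thesis by simp
qed

text \<open>One interval is kept for each of two directions, \<open>n + 1\<close> chain lengths and
  at most \<open>2 * opt I\<close> occupied cells.\<close>

lemma max_space_chain_algorithm:
  assumes "finite I" "I \<subseteq> unit_intervals" "xs \<in> permutations_of_set I"
  shows "max_space (chain_algorithm n) xs \<le> 4 * (n + 1) * opt I"
proof -
  have "length (memory_after (chain_algorithm n) (take k xs)) \<le> 4 * (n + 1) * opt I" for k
  proof -
    have "card (summary n ys) \<le> 2 * (n + 1) * card (cell ` I)" if "set ys \<subseteq> I" for ys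
      using that
    proof (induction ys rule: rev_induct)
      case (snoc y ys)
      let ?T = "insert y (summary n ys)"
      have T: "finite ?T" "?T \<subseteq> I"
        using summary_subset[of n ys] snoc.prems by auto
      have "card (summary n (ys @ [y])) \<le> 2 * (n + 1) * card (cell ` ?T)"
        using card_core_le[OF T(1)] by simp
      also have "\<dots> \<le> 2 * (n + 1) * card (cell ` I)"
        using T assms(1) by (intro mult_left_mono card_mono image_mono) auto
      finally show ?case .
    qed simp
    moreover have "set (take k xs) \<subseteq> I"
      using assms(3) set_take_subset[of k xs] by (auto simp: permutations_of_set_def)
    ultimately have "card (summary n (take k xs)) \<le> 2 * (n + 1) * card (cell ` I)"
      by blast
    also have "\<dots> \<le> 2 * (n + 1) * (2 * opt I)"
      using card_cells_le[OF assms(1,2)] by (intro mult_left_mono) auto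
    finally show ?thesis
      using words(3)[of "summary n (take k xs)"] summary_subset[of n "take k xs"]
      by (simp add: memory_chain_algorithm algebra_simps)
  qed
  then show ?thesis
    unfolding max_space_def by (intro Max.boundedI) auto
qed

lemma expectation_chain_algorithm:
  assumes I: "finite I" "I \<subseteq> unit_intervals"
  shows "measure_pmf.expectation (random_order I) (\<lambda>xs. real (card (output_of (chain_algorithm 4) xs)))
    \<ge> 0.7401 * real (opt I)"
proof -
  define S where "S = largest_independent I"
  define D where "D = cell ` S"
  \<comment> \<open>An independent set has at most one interval per cell, so the optimum
    \<open>S\<close> is indexed by its cells.\<close>
  define rep where "rep = inv_into S cell"
  define lt where "lt xs c d \<longleftrightarrow> before xs (rep c) (rep d)" for xs c d
  have S: "S \<subseteq> I" "disjoint S" "opt I = card S"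
    using largest_independent(1)[OF I(1)] opt_eq_card_largest_independent[OF I(1)]
    by (auto simp: S_def independent_subsets_def)
  have finS: "finite S"
    using S(1) I(1) finite_subset by blast
  have rep: "rep c \<in> S" "cell (rep c) = c" if "c \<in> D" for c
    using that by (auto simp: D_def rep_def intro: inv_into_into f_inv_into_f)
  have "inj_on cell S"
  proof (rule inj_onI)
    fix x y assume "x \<in> S" "y \<in> S" "cell x = cell y"
    then show "x = y"
      using inter_same_cell[of x y] disjointD[OF S(2), of x y] S(1) I(2) by blast
  qed
  then have cardD: "card D = opt I"
    by (simp add: D_def S(3) card_image)
  have rep_less: "pos (rep c) < pos (rep (c + 1))" if "c \<in> D" "c + 1 \<in> D" for c
  proof -
    have "rep c \<noteq> rep (c + 1)"
      using rep(2)[OF that(1)] rep(2)[OF that(2)] by auto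
    then have "rep c \<inter> rep (c + 1) = {}"
      using disjointD[OF S(2)] rep that by blast
    moreover have "rep c \<in> unit_intervals" "rep (c + 1) \<in> unit_intervals"
      using rep(1) that S(1) I(2) by blast+
    ultimately show ?thesis
      using disjoint_adjacent_cells_iff[of "rep c" "rep (c + 1)"] rep(2) that by simp
  qed
  let ?f = "\<lambda>xs. real (card D)
     + card {c. local_min D (lt xs) (c - 1) \<and> local_min D (lt xs) (c + 1) \<and> \<not> local_min D (lt xs) (c - 3)}
     - card {c. local_min D (lt xs) c}
     - (real (card {c. rising D (lt xs) 1 c 5}) + card {c. rising D (lt xs) (-1) c 5})"
  \<comment> \<open>For every single arrival order the output is at least as large as the set of
    surviving cells; expectations are taken only afterwards.\<close>
  have bound: "?f xs \<le> card (output_of (chain_algorithm 4) xs)" if xs: "xs \<in> permutations_of_set I" for xs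
  proof -
    have finD: "finite D"
      using finS by (simp add: D_def)
    obtain A where A: "A \<subseteq> D" "\<And>c. \<not> local_min A (lt xs) c"
        "\<And>s c. s \<in> {1, -1} \<Longrightarrow> \<not> rising A (lt xs) s c 5"
      and card_A: "card D + card {c. local_min D (lt xs) (c - 1) \<and> local_min D (lt xs) (c + 1) \<and> \<not> local_min D (lt xs) (c - 3)}
        \<le> card A + card {c. local_min D (lt xs) c}
          + (card {c. rising D (lt xs) 1 c 5} + card {c. rising D (lt xs) (-1) c 5})"
      using exists_unimodal_cells[OF finD, of "lt xs" 5] by blast
    have set_xs: "set xs = I" "distinct xs"
      using xs by (auto simp: permutations_of_set_def)
    have "\<exists>X \<in> independent_subsets (summary 4 xs). card X = card A"
    proof (rule summary_has_independent)
      show "lt xs = (\<lambda>c d. before xs (rep c) (rep d))"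
        by (simp add: lt_def fun_eq_iff)
      show "rep c \<in> set xs \<and> cell (rep c) = c" if "c \<in> A" for c
        using rep that A(1) S(1) set_xs by blast
      show "pos (rep c) < pos (rep (c + 1))" if "c \<in> A" "c + 1 \<in> A" for c
        using rep_less that A(1) by blast
      \<comment> \<open>Stretches with five comparisons were destroyed, so the parameter 4, that is
        chains of up to five intervals, matches.\<close>
      show "\<not> rising A (lt xs) s c (Suc 4)" if "s \<in> {1, -1}" for s c
        using A(3)[OF that, of c] by simp
    qed (use A(2) I(2) set_xs in auto)
    then obtain X where "X \<in> independent_subsets (summary 4 xs)" "card X = card A"
      by blast
    then have "card A \<le> card (output_of (chain_algorithm 4) xs)"
      using largest_independent(2)[of "summary 4 xs" X] summary_subset[of 4 xs]
      by (simp add: output_chain_algorithm)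
    then show ?thesis
      using card_A by linarith
  qed
  have fin_supp: "finite (set_pmf (random_order I))"
    using I(1) by (simp add: random_order_def)
  have "0.7401 * real (opt I) \<le> measure_pmf.expectation (random_order I) ?f"
    unfolding cardD[symmetric] lt_def
  proof (rule expected_unimodal_cells[OF I(1)])
    show "inj_on rep D"
      by (rule inj_onI) (metis rep(2))
    show "rep ` D \<subseteq> I"
      using rep(1) S(1) by blast
    show "finite D"
      using finS by (simp add: D_def)
  qed
  also have "\<dots> \<le> measure_pmf.expectation (random_order I) (\<lambda>xs. real (card (output_of (chain_algorithm 4) xs)))"
  proof (rule integral_mono_AE)
    show "AE xs in random_order I. ?f xs \<le> real (card (output_of (chain_algorithm 4) xs))"
      using bound I(1) by (simp add: AE_measure_pmf_iff random_order_def)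
  qed (use fin_supp in \<open>auto intro: integrable_measure_pmf_finite\<close>)
  finally show ?thesis .
qed

theorem theorem1:
  shows "\<exists>(A :: real set streaming_algorithm) (K :: nat) (C :: nat).
    valid_algorithm K A \<and>
    (\<forall>I :: real set set. finite I \<and> I \<subseteq> unit_intervals \<longrightarrow>
       (\<forall>xs \<in> permutations_of_set I.
          max_space A xs \<le> C * opt I \<and> output_of A xs \<in> independent_subsets I) \<and>
       measure_pmf.expectation (random_order I) (\<lambda>xs. real (card (output_of A xs)))
         \<ge> 0.7401 * real (opt I))"
proof (intro exI conjI allI impI ballI; (elim conjE)?)
  show "valid_algorithm 0 (chain_algorithm 4)"
    by (rule valid_chain_algorithm)
next
  fix I :: "real set set" and xs
  assume I: "finite I" "I \<subseteq> unit_intervals" and xs: "xs \<in> permutations_of_set I"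
  show "max_space (chain_algorithm 4) xs \<le> 20 * opt I"
    using max_space_chain_algorithm[OF I xs, of 4] by simp
  have "finite (summary 4 xs)" "summary 4 xs \<subseteq> I"
    using summary_subset[of 4 xs] xs by (auto simp: permutations_of_set_def)
  then show "output_of (chain_algorithm 4) xs \<in> independent_subsets I"
    using largest_independent(1)[of "summary 4 xs"]
    by (auto simp: output_chain_algorithm independent_subsets_def)
next
  fix I :: "real set set"
  assume "finite I" "I \<subseteq> unit_intervals"
  then show "0.7401 * real (opt I) \<le>
      measure_pmf.expectation (random_order I) (\<lambda>xs. real (card (output_of (chain_algorithm 4) xs)))"
    by (rule expectation_chain_algorithm)
qed

end
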